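(* Let $t\ge 2$ and let $r,s$ be fixed positive integers. Then, as $m\to\infty$, $$\mathrm{forb}(m,\{Q_3(t),\,I_r\times I_s^c\})=\Omega(ex(m,K_{r,s})).$$
   Context: A matrix is simple if it is a $(0,1)$-matrix with no repeated columns. $F\prec A$ means that some submatrix of $A$ is a row and column permutation of $F$. For a family $\mathcal F$ of $(0,1)$-matrices, $\mathrm{forb}(m,\mathcal F)$ is the maximum number of columns of an $m$-rowed simple matrix $A$ with $F\nprec A$ for all $F\in\mathcal F$. $I_k$ is the $k\times k$ identity matrix and $I_k^c$ its $(0,1)$-complement. For an $m_1\times n_1$ matrix $A$ and an $m_2\times n_2$ matrix $B$, $A\times B$ is the $(m_1+m_2)\times n_1n_2$ matrix whose columns are all combinations obtained by placing a column of $A$ on top of a column of $B$. For $t\ge 2$, $Q_3(t)$ is the $2\times(2t+2)$ matrix whose columns are: $\begin{bmatrix}0\\0\end{bmatrix}$ once, $\begin{bmatrix}1\\0\end{bmatrix}$ exactly $t$ times, $\begin{bmatrix}0\\1\end{bmatrix}$ exactly $t$ times, and $\begin{bmatrix}1\\1\end{bmatrix}$ once. $ex(m,K_{r,s})$ is the largest number of edges of an $m$-vertex graph with no subgraph isomorphic to the complete bipartite graph $K_{r,s}$. *)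

theory Defs
  imports
    "Jordan_Normal_Form.DL_Submatrix"
    "Graph_Theory.Kuratowski"
    "HOL-Combinatorics.Permutations"
    "HOL-Library.Landau_Symbols"
begin

section \<open>Configurations in (0,1)-matrices\<close>

definition zero_one_mat :: "int mat \<Rightarrow> bool" where
  "zero_one_mat A \<longleftrightarrow> elements_mat A \<subseteq> {0, 1}"

definition simple_mat :: "int mat \<Rightarrow> bool" where
  "simple_mat A \<longleftrightarrow> zero_one_mat A \<and> distinct (cols A)"

definition row_col_perm :: "int mat \<Rightarrow> int mat \<Rightarrow> bool" where
  "row_col_perm F B \<longleftrightarrow>
     (\<exists>p q. p permutes {..<dim_row F} \<and> q permutes {..<dim_col F} \<and>
        B = mat (dim_row F) (dim_col F) (\<lambda>(i, j). F $$ (p i, q j)))"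

definition config_in :: "int mat \<Rightarrow> int mat \<Rightarrow> bool"  (infix \<open>\<prec>\<^sub>c\<close> 50) where
  "F \<prec>\<^sub>c A \<longleftrightarrow>
     (\<exists>I J. I \<subseteq> {..<dim_row A} \<and> J \<subseteq> {..<dim_col A} \<and> row_col_perm F (submatrix A I J))"

text \<open>
  For every m the set below is finite, as a simple matrix with m rows has at most 2^m columns.
  It is nonempty if every member of the family has a column, because then the matrix
  with m rows and no columns qualifies.
\<close>
definition forb :: "nat \<Rightarrow> int mat set \<Rightarrow> nat" where
  "forb m \<F> = Max {dim_col A | A. simple_mat A \<and> dim_row A = m \<and> (\<forall>F\<in>\<F>. \<not> F \<prec>\<^sub>c A)}"

definition complement_mat :: "int mat \<Rightarrow> int mat" where
  "complement_mat A = map_mat (\<lambda>x. 1 - x) A"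

text \<open>Column number a * dim_col B + b of the product is column a of A on top of column b of B.\<close>
definition product_mat :: "int mat \<Rightarrow> int mat \<Rightarrow> int mat"  (infixr \<open>\<times>\<^sub>c\<close> 70) where
  "A \<times>\<^sub>c B = mat (dim_row A + dim_row B) (dim_col A * dim_col B)
     (\<lambda>(i, j). if i < dim_row A then A $$ (i, j div dim_col B)
               else B $$ (i - dim_row A, j mod dim_col B))"

definition Q3 :: "nat \<Rightarrow> int mat" where
  "Q3 t = mat_of_cols_list 2
     ([[0, 0]] @ replicate t [1, 0] @ replicate t [0, 1] @ [[1, 1]])"


section \<open>The extremal number of a complete bipartite graph\<close>

text \<open>
  A finite simple graph is a loopfree symmetric digraph (locale \<^locale>\<open>pair_graph\<close>), in which
  every edge is represented by two opposite arcs; edges are counted as unordered pairs.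
  The predicate \<^const>\<open>complete_bipartite_digraph\<close> is closed under isomorphism.
\<close>
definition edges :: "nat pair_pre_digraph \<Rightarrow> nat set set" where
  "edges G = {{u, v} | u v. (u, v) \<in> parcs G}"

definition ex_bipartite :: "nat \<Rightarrow> nat \<Rightarrow> nat \<Rightarrow> nat" where
  "ex_bipartite m r s =
     Max {card (edges G) | G. pair_graph G \<and> pverts G = {..<m} \<and>
            \<not> (\<exists>H. subgraph H (with_proj G) \<and> complete_bipartite_digraph r s H)}"

end

theory Submission
  imports Defs
begin

text \<open>
  For r, s at least 2, take a K_{r,s}-free graph on the rows and a cut (X, Y) containing at least
  half of its edges. An edge xy with x in X and y in Y becomes the column of the set
  {x} \<union> (Y - {y}): the restriction of I \<times> I^c to the edges of the cut. On two rows of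
  the same side one of the columns 11 and 00 is missing, and on rows x in X, y in Y the
  pattern 10 occurs only in the column of xy; this excludes Q_3(t). In a copy of
  I_r \<times> I_s^c every row of I_r and every row of I_s^c have a common 00 and a common 11, so
  they lie on opposite sides, and a 1 over a 0 at the right place makes them adjacent, which gives
  a K_{r,s}. If r = 1 or s = 1, the extremal number is at most linear (and 0 for r = s = 1), and
  I_m or I_m^c has m columns.
\<close>

section \<open>Configurations in matrices and traces of set families\<close>

text \<open>Columns are identified with the sets of rows in which they have a 1.\<close>

definition trace_of :: "int mat \<Rightarrow> nat set \<Rightarrow> nat set set \<Rightarrow> bool" where
  "trace_of F V C \<longleftrightarrow>
     (\<exists>\<rho> \<kappa>. inj_on \<rho> {..<dim_row F} \<and> \<rho> ` {..<dim_row F} \<subseteq> V \<and>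
        inj_on \<kappa> {..<dim_col F} \<and> \<kappa> ` {..<dim_col F} \<subseteq> C \<and>
        (\<forall>i<dim_row F. \<forall>j<dim_col F. F $$ (i, j) = of_bool (\<rho> i \<in> \<kappa> j)))"

definition incidence_mat :: "nat \<Rightarrow> nat set list \<Rightarrow> int mat" where
  "incidence_mat m xs = mat m (length xs) (\<lambda>(i, j). of_bool (i \<in> xs ! j))"

lemma dim_incidence_mat [simp]:
  "dim_row (incidence_mat m xs) = m" "dim_col (incidence_mat m xs) = length xs"
  by (simp_all add: incidence_mat_def)

lemma simple_incidence_mat:
  assumes "distinct xs" "set xs \<subseteq> Pow {..<m}"
  shows "simple_mat (incidence_mat m xs)"
proof -
  have "zero_one_mat (incidence_mat m xs)"
    unfolding zero_one_mat_def by (auto simp: incidence_mat_def)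
  moreover have "distinct (cols (incidence_mat m xs))"
    unfolding distinct_conv_nth
  proof (intro allI impI)
    fix i j assume ij: "i < length (cols (incidence_mat m xs))"
      "j < length (cols (incidence_mat m xs))" "i \<noteq> j"
    then have l: "i < length xs" "j < length xs" by auto
    then have "xs ! i \<noteq> xs ! j" using assms(1) ij(3) by (simp add: nth_eq_iff_index_eq)
    moreover have "xs ! i \<subseteq> {..<m}" "xs ! j \<subseteq> {..<m}"
      using assms(2) l by (meson PowD nth_mem subsetD)+
    ultimately obtain k where k: "k < m" "(k \<in> xs ! i) \<noteq> (k \<in> xs ! j)" by blast
    then have "col (incidence_mat m xs) i $ k \<noteq> col (incidence_mat m xs) j $ k"
      using l by (simp add: incidence_mat_def)
    then show "cols (incidence_mat m xs) ! i \<noteq> cols (incidence_mat m xs) ! j"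
      using l by auto
  qed
  ultimately show ?thesis by (simp add: simple_mat_def)
qed

text \<open>Turns a submatrix together with two permutations into one injection on rows and one on
  columns, so that later arguments only handle entries.\<close>

lemma config_inE:
  assumes "F \<prec>\<^sub>c A"
  obtains \<rho> \<kappa> where "inj_on \<rho> {..<dim_row F}" "\<rho> ` {..<dim_row F} \<subseteq> {..<dim_row A}"
    "inj_on \<kappa> {..<dim_col F}" "\<kappa> ` {..<dim_col F} \<subseteq> {..<dim_col A}"
    "\<And>i j. i < dim_row F \<Longrightarrow> j < dim_col F \<Longrightarrow> F $$ (i, j) = A $$ (\<rho> i, \<kappa> j)"
proof -
  obtain I J p q where I: "I \<subseteq> {..<dim_row A}" and J: "J \<subseteq> {..<dim_col A}"
    and p: "p permutes {..<dim_row F}" and q: "q permutes {..<dim_col F}"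
    and eq: "submatrix A I J = mat (dim_row F) (dim_col F) (\<lambda>(i, j). F $$ (p i, q j))"
    using assms unfolding config_in_def row_col_perm_def by blast
  have II: "{i. i < dim_row A \<and> i \<in> I} = I" and JJ: "{j. j < dim_col A \<and> j \<in> J} = J"
    using I J by auto
  have cI: "card I = dim_row F" and cJ: "card J = dim_col F"
    using arg_cong[OF eq, of dim_row] arg_cong[OF eq, of dim_col] II JJ
    by (simp_all add: dim_submatrix)
  \<comment> \<open>The submatrix carries at \<open>(i, j)\<close> the entry of \<open>F\<close> at
    \<open>(p i, q j)\<close>, so an entry of \<open>F\<close> is located by the inverse
    permutations, followed by the increasing enumerations \<open>pick I\<close> and
    \<open>pick J\<close>.\<close>
  define p' q' where "p' = inv_into UNIV p" and "q' = inv_into UNIV q"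
  have inv_p: "p' permutes {..<dim_row F}" and inv_q: "q' permutes {..<dim_col F}"
    using p q by (simp_all add: p'_def q'_def permutes_inv)
  have cancel: "p (p' i) = i" "q (q' i) = i" for i
    using p q by (simp_all add: p'_def q'_def permutes_inverses)
  have pick_inj: "inj_on (pick S) {..<card S}" for S
    by (rule linorder_inj_onI) (auto dest: pick_mono_le)
  have pick_range: "pick S ` {..<card S} \<subseteq> S" for S
    by (auto intro: pick_in_set_le)
  show ?thesis
  proof
    show "inj_on (pick I \<circ> p') {..<dim_row F}" "inj_on (pick J \<circ> q') {..<dim_col F}"
      using pick_inj[of I] pick_inj[of J] cI cJ inv_p inv_q
      by (auto intro!: comp_inj_on simp: permutes_image permutes_inj_on)
    show "(pick I \<circ> p') ` {..<dim_row F} \<subseteq> {..<dim_row A}"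
      "(pick J \<circ> q') ` {..<dim_col F} \<subseteq> {..<dim_col A}"
      using pick_range[of I] pick_range[of J] cI cJ inv_p inv_q I J
      unfolding image_comp[symmetric] by (auto simp: permutes_image)
    fix i j assume ij: "i < dim_row F" "j < dim_col F"
    have lt: "p' i < dim_row F" "q' j < dim_col F"
      using permutes_in_image[OF inv_p, of i] permutes_in_image[OF inv_q, of j] ij by simp_all
    then have "submatrix A I J $$ (p' i, q' j) = F $$ (i, j)"
      by (simp add: eq cancel)
    moreover have "submatrix A I J $$ (p' i, q' j) = A $$ (pick I (p' i), pick J (q' j))"
      using lt by (intro submatrix_index) (simp_all add: II JJ cI cJ)
    ultimately show "F $$ (i, j) = A $$ ((pick I \<circ> p') i, (pick J \<circ> q') j)"
      by simp
  qed
qed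

text \<open>Distinctness of \<open>xs\<close> turns different column positions into different sets,
  so equal columns of \<open>F\<close> still occupy different members of the family.\<close>

lemma config_in_incidence_mat:
  assumes "F \<prec>\<^sub>c incidence_mat m xs" "distinct xs"
  shows "trace_of F {..<m} (set xs)"
proof -
  obtain \<rho> \<kappa> where \<rho>: "inj_on \<rho> {..<dim_row F}" "\<rho> ` {..<dim_row F} \<subseteq> {..<m}"
    and \<kappa>: "inj_on \<kappa> {..<dim_col F}" "\<kappa> ` {..<dim_col F} \<subseteq> {..<length xs}"
    and F: "\<And>i j. i < dim_row F \<Longrightarrow> j < dim_col F \<Longrightarrow> F $$ (i, j) = incidence_mat m xs $$ (\<rho> i, \<kappa> j)"
    using config_inE[OF assms(1)] by (metis dim_incidence_mat)
  have "inj_on ((!) xs \<circ> \<kappa>) {..<dim_col F}"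
    using \<kappa> assms(2) by (intro comp_inj_on) (auto intro: inj_on_nth)
  moreover have "((!) xs \<circ> \<kappa>) ` {..<dim_col F} \<subseteq> set xs"
    using \<kappa>(2) by auto
  moreover have "F $$ (i, j) = of_bool (\<rho> i \<in> ((!) xs \<circ> \<kappa>) j)"
    if "i < dim_row F" "j < dim_col F" for i j
  proof -
    have "\<rho> i < m" "\<kappa> j < length xs" using that \<rho>(2) \<kappa>(2) by auto
    then show ?thesis using F[OF that] by (simp add: incidence_mat_def)
  qed
  ultimately show ?thesis
    using \<rho> unfolding trace_of_def by blast
qed

text \<open>A (0,1)-column is determined by its support. The bound makes the set under
  \<open>Max\<close> in \<open>forb\<close> finite.\<close>

lemma simple_mat_dim_col_le:
  assumes "simple_mat A"
  shows "dim_col A \<le> 2 ^ dim_row A"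
proof -
  let ?supp = "\<lambda>j. {i. i < dim_row A \<and> A $$ (i, j) = 1}"
  have "inj_on ?supp {..<dim_col A}"
  proof (rule inj_onI)
    fix j k assume jk: "j \<in> {..<dim_col A}" "k \<in> {..<dim_col A}" "?supp j = ?supp k"
    have "col A j = col A k"
    proof (rule eq_vecI)
      fix i assume "i < dim_vec (col A k)"
      then have i: "i < dim_row A" by simp
      have "A $$ (i, l) \<in> {0, 1}" if "l < dim_col A" for l
        using assms i that unfolding simple_mat_def zero_one_mat_def by blast
      then have "A $$ (i, j) \<in> {0, 1}" "A $$ (i, k) \<in> {0, 1}" using jk(1,2) by auto
      moreover have "A $$ (i, j) = 1 \<longleftrightarrow> A $$ (i, k) = 1" using jk(3) i by blast
      ultimately have "A $$ (i, j) = A $$ (i, k)" by auto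
      then show "col A j $ i = col A k $ i" using i jk by simp
    qed simp
    then show "j = k"
      using assms jk(1,2) nth_eq_iff_index_eq[of "cols A" j k] by (simp add: simple_mat_def)
  qed
  then have "card {..<dim_col A} \<le> card (Pow {..<dim_row A})"
    by (rule card_inj_on_le) auto
  then show ?thesis by (simp add: card_Pow)
qed

text \<open>The source of all lower bounds: listing \<open>C\<close> without repetition gives an
  incidence matrix that competes in the maximum.\<close>

lemma card_le_forb:
  assumes "C \<subseteq> Pow {..<m}" "\<And>F. F \<in> \<F> \<Longrightarrow> \<not> trace_of F {..<m} C"
  shows "card C \<le> forb m \<F>"
proof -
  have "finite C" using assms(1) by (rule finite_subset) simp
  then obtain xs where xs: "set xs = C" "distinct xs" using finite_distinct_list by blast
  have "dim_col (incidence_mat m xs) = card C"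
    using distinct_card[OF xs(2)] xs(1) by simp
  moreover have "simple_mat (incidence_mat m xs)"
    using simple_incidence_mat xs assms(1) by simp
  moreover have "\<forall>F\<in>\<F>. \<not> F \<prec>\<^sub>c incidence_mat m xs"
    using config_in_incidence_mat[OF _ xs(2)] assms(2) xs(1) by blast
  ultimately have "card C \<in> {dim_col A | A. simple_mat A \<and> dim_row A = m \<and> (\<forall>F\<in>\<F>. \<not> F \<prec>\<^sub>c A)}"
    by (auto intro!: exI[of _ "incidence_mat m xs"])
  moreover have "finite {dim_col A | A. simple_mat A \<and> dim_row A = m \<and> (\<forall>F\<in>\<F>. \<not> F \<prec>\<^sub>c A)}"
    by (rule finite_subset[of _ "{..2 ^ m}"]) (auto dest: simple_mat_dim_col_le)
  ultimately show ?thesis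
    unfolding forb_def by (intro Max_ge)
qed

section \<open>The two forbidden configurations in terms of sets\<close>

text \<open>Since \<open>t\<close> is at least 2, two different columns of each of the types 10 and
  01 can be picked, next to one of type 00 and one of type 11.\<close>

lemma trace_of_Q3E:
  assumes "trace_of (Q3 t) V C" "t \<ge> 2"
  obtains u v a b c c' d d' where "u \<in> V" "v \<in> V" "u \<noteq> v" "{a, b, c, c', d, d'} \<subseteq> C"
    "u \<notin> a" "v \<notin> a" "u \<in> b" "v \<in> b"
    "c \<noteq> c'" "u \<in> c" "v \<notin> c" "u \<in> c'" "v \<notin> c'"
    "d \<noteq> d'" "u \<notin> d" "v \<in> d" "u \<notin> d'" "v \<in> d'"
proof -
  let ?L = "[[0, 0]] @ replicate t [1, 0] @ replicate t [0, 1] @ [[1, 1::int]]"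
  have dims: "dim_row (Q3 t) = 2" "dim_col (Q3 t) = 2 * t + 2"
    by (simp_all add: Q3_def mat_of_cols_list_def)
  obtain \<rho> \<kappa> where \<rho>: "inj_on \<rho> {..<2}" "\<rho> ` {..<2} \<subseteq> V" and \<kappa>: "inj_on \<kappa> {..<2 * t + 2}" "\<kappa> ` {..<2 * t + 2} \<subseteq> C"
    and F: "\<forall>i<2. \<forall>j<2 * t + 2. Q3 t $$ (i, j) = of_bool (\<rho> i \<in> \<kappa> j)"
    using assms(1) unfolding trace_of_def dims by (elim exE conjE) (rule that)
  have entry: "of_bool (\<rho> 0 \<in> \<kappa> j) = ?L ! j ! 0" "of_bool (\<rho> 1 \<in> \<kappa> j) = ?L ! j ! 1"
    if "j < 2 * t + 2" for j
    using F that by (simp_all add: Q3_def mat_of_cols_list_def)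
  show ?thesis
  proof
    show "\<rho> 0 \<in> V" "\<rho> 1 \<in> V" using \<rho>(2) by auto
    show "\<rho> 0 \<noteq> \<rho> 1" using inj_onD[OF \<rho>(1), of 0 1] by auto
    \<comment> \<open>In \<open>Q3 t\<close> column 0 is 00, columns 1 to \<open>t\<close> are 10,
      columns \<open>t + 1\<close> to \<open>2 * t\<close> are 01, and column
      \<open>2 * t + 1\<close> is 11.\<close>
    show "{\<kappa> 0, \<kappa> (2 * t + 1), \<kappa> 1, \<kappa> 2, \<kappa> (t + 1), \<kappa> (t + 2)} \<subseteq> C"
      using \<kappa>(2) assms(2) by auto
    show "\<kappa> 1 \<noteq> \<kappa> 2" "\<kappa> (t + 1) \<noteq> \<kappa> (t + 2)"
      using \<kappa>(1) assms(2) by (auto simp: inj_on_eq_iff)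
    show "\<rho> 0 \<notin> \<kappa> 0" "\<rho> 1 \<notin> \<kappa> 0"
      using entry[of 0] by auto
    show "\<rho> 0 \<in> \<kappa> (2 * t + 1)" "\<rho> 1 \<in> \<kappa> (2 * t + 1)"
      using entry[of "2 * t + 1"] by (auto simp: nth_append of_bool_def split: if_splits)
    show "\<rho> 0 \<in> \<kappa> 1" "\<rho> 1 \<notin> \<kappa> 1"
      using entry[of 1] assms(2) by (auto simp: nth_append of_bool_def split: if_splits)
    show "\<rho> 0 \<in> \<kappa> 2" "\<rho> 1 \<notin> \<kappa> 2"
      using entry[of 2] assms(2) by (auto simp: nth_append nth_Cons' of_bool_def split: if_splits)
    show "\<rho> 0 \<notin> \<kappa> (t + 1)" "\<rho> 1 \<in> \<kappa> (t + 1)"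
      using entry[of "t + 1"] assms(2) by (auto simp: nth_append of_bool_def split: if_splits)
    show "\<rho> 0 \<notin> \<kappa> (t + 2)" "\<rho> 1 \<in> \<kappa> (t + 2)"
      using entry[of "t + 2"] assms(2) by (auto simp: nth_append of_bool_def split: if_splits)
  qed
qed

text \<open>Columns get two indices: \<open>\<kappa> a b\<close> is the image of column
  \<open>a * s + b\<close>, which is column \<open>a\<close> of the identity on top of column
  \<open>b\<close> of the complement.\<close>

lemma trace_of_productE:
  assumes "trace_of (1\<^sub>m r \<times>\<^sub>c complement_mat (1\<^sub>m s)) V C"
  obtains \<rho> \<kappa> where "inj_on \<rho> {..<r + s}" "\<rho> ` {..<r + s} \<subseteq> V"
    "\<forall>a<r. \<forall>b<s. \<kappa> a b \<in> C"
    "\<forall>i<r. \<forall>a<r. \<forall>b<s. \<rho> i \<in> \<kappa> a b \<longleftrightarrow> i = a"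
    "\<forall>j<s. \<forall>a<r. \<forall>b<s. \<rho> (r + j) \<in> \<kappa> a b \<longleftrightarrow> j \<noteq> b"
proof -
  let ?F = "1\<^sub>m r \<times>\<^sub>c complement_mat (1\<^sub>m s)"
  have dims: "dim_row ?F = r + s" "dim_col ?F = r * s"
    by (simp_all add: product_mat_def complement_mat_def)
  obtain \<rho> \<kappa> where \<rho>: "inj_on \<rho> {..<r + s}" "\<rho> ` {..<r + s} \<subseteq> V"
    and \<kappa>: "\<kappa> ` {..<r * s} \<subseteq> C"
    and F: "\<forall>i<r + s. \<forall>j<r * s. ?F $$ (i, j) = of_bool (\<rho> i \<in> \<kappa> j)"
    using assms unfolding trace_of_def dims by (elim exE conjE) (rule that)
  \<comment> \<open>Keeps the combined index in range; \<open>div\<close> and \<open>mod\<close> by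
    \<open>s\<close> then recover \<open>a\<close> and \<open>b\<close>.\<close>
  have lt: "a * s + b < r * s" if "a < r" "b < s" for a b
  proof -
    have "a * s + b < Suc a * s" using that by simp
    also have "\<dots> \<le> r * s" using that by (intro mult_le_mono1) simp
    finally show ?thesis .
  qed
  show ?thesis
  proof
    show "inj_on \<rho> {..<r + s}" "\<rho> ` {..<r + s} \<subseteq> V" by (fact \<rho>)+
    show "\<forall>a<r. \<forall>b<s. \<kappa> (a * s + b) \<in> C"
      using \<kappa> lt by blast
    have top: "?F $$ (i, a * s + b) = of_bool (i = a)" if "i < r" "a < r" "b < s" for i a b
      using that lt[of a b] by (auto simp: product_mat_def complement_mat_def)
    have bottom: "?F $$ (r + j, a * s + b) = of_bool (j \<noteq> b)" if "j < s" "a < r" "b < s" for j a b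
      using that lt[of a b] by (auto simp: product_mat_def complement_mat_def)
    show "\<forall>i<r. \<forall>a<r. \<forall>b<s. \<rho> i \<in> \<kappa> (a * s + b) \<longleftrightarrow> i = a"
    proof (intro allI impI)
      fix i a b assume *: "i < r" "a < r" "b < s"
      have "?F $$ (i, a * s + b) = of_bool (\<rho> i \<in> \<kappa> (a * s + b))"
        using F[rule_format, of i "a * s + b"] lt * by simp
      then show "\<rho> i \<in> \<kappa> (a * s + b) \<longleftrightarrow> i = a"
        unfolding top[OF *] by (simp only: of_bool_eq_iff)
    qed
    show "\<forall>j<s. \<forall>a<r. \<forall>b<s. \<rho> (r + j) \<in> \<kappa> (a * s + b) \<longleftrightarrow> j \<noteq> b"
    proof (intro allI impI)
      fix j a b assume *: "j < s" "a < r" "b < s"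
      have "?F $$ (r + j, a * s + b) = of_bool (\<rho> (r + j) \<in> \<kappa> (a * s + b))"
        using F[rule_format, of "r + j" "a * s + b"] lt * by simp
      then show "\<rho> (r + j) \<in> \<kappa> (a * s + b) \<longleftrightarrow> j \<noteq> b"
        unfolding bottom[OF *] by (simp only: of_bool_eq_iff)
    qed
  qed
qed

section \<open>Linear lower bounds from singletons and their complements\<close>

text \<open>A singleton never shows 11 on two rows, whereas both configurations contain a 11. In the
  product it needs \<open>s \<ge> 2\<close>.\<close>

lemma forb_ge_identity:
  assumes "t \<ge> 2" "r \<ge> 1" "s \<ge> 2"
  shows "m \<le> forb m {Q3 t, 1\<^sub>m r \<times>\<^sub>c complement_mat (1\<^sub>m s)}"
proof -
  let ?C = "(\<lambda>i. {i}) ` {..<m}"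
  have "\<not> trace_of (Q3 t) {..<m} ?C"
    by (auto elim!: trace_of_Q3E[OF _ assms(1)])
  moreover have "\<not> trace_of (1\<^sub>m r \<times>\<^sub>c complement_mat (1\<^sub>m s)) {..<m} ?C"
  proof
    assume "trace_of (1\<^sub>m r \<times>\<^sub>c complement_mat (1\<^sub>m s)) {..<m} ?C"
    then obtain \<rho> \<kappa> where \<rho>: "inj_on \<rho> {..<r + s}"
      and \<kappa>: "\<forall>a<r. \<forall>b<s. \<kappa> a b \<in> ?C"
        "\<forall>i<r. \<forall>a<r. \<forall>b<s. \<rho> i \<in> \<kappa> a b \<longleftrightarrow> i = a"
        "\<forall>j<s. \<forall>a<r. \<forall>b<s. \<rho> (r + j) \<in> \<kappa> a b \<longleftrightarrow> j \<noteq> b"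
      by (rule trace_of_productE)
    \<comment> \<open>Row 0 of the identity and row 1 of the complement both have a 1 in column
      \<open>(0, 0)\<close>.\<close>
    have "\<rho> 0 \<in> \<kappa> 0 0" "\<rho> (r + 1) \<in> \<kappa> 0 0" "\<kappa> 0 0 \<in> ?C"
      using assms \<kappa>(1)[rule_format, of 0 0] \<kappa>(2)[rule_format, of 0 0 0]
        \<kappa>(3)[rule_format, of 1 0 0] by simp_all
    moreover have "\<rho> 0 \<noteq> \<rho> (r + 1)"
      using \<rho> assms by (auto simp: inj_on_eq_iff)
    ultimately show False by auto
  qed
  ultimately have "card ?C \<le> forb m {Q3 t, 1\<^sub>m r \<times>\<^sub>c complement_mat (1\<^sub>m s)}"
    by (intro card_le_forb) auto
  then show ?thesis by (simp add: card_image)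
qed


text \<open>Dually, the complement of a singleton never shows 00, and \<open>r \<ge> 2\<close> gives
  a 00 in the product.\<close>

lemma forb_ge_complement:
  assumes "t \<ge> 2" "r \<ge> 2" "s \<ge> 1"
  shows "m \<le> forb m {Q3 t, 1\<^sub>m r \<times>\<^sub>c complement_mat (1\<^sub>m s)}"
proof -
  let ?C = "(\<lambda>i. {..<m} - {i}) ` {..<m}"
  have "\<not> trace_of (Q3 t) {..<m} ?C"
    by (auto elim!: trace_of_Q3E[OF _ assms(1)])
  moreover have "\<not> trace_of (1\<^sub>m r \<times>\<^sub>c complement_mat (1\<^sub>m s)) {..<m} ?C"
  proof
    assume "trace_of (1\<^sub>m r \<times>\<^sub>c complement_mat (1\<^sub>m s)) {..<m} ?C"
    then obtain \<rho> \<kappa> where \<rho>: "inj_on \<rho> {..<r + s}" "\<rho> ` {..<r + s} \<subseteq> {..<m}"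
      and \<kappa>: "\<forall>a<r. \<forall>b<s. \<kappa> a b \<in> ?C"
        "\<forall>i<r. \<forall>a<r. \<forall>b<s. \<rho> i \<in> \<kappa> a b \<longleftrightarrow> i = a"
        "\<forall>j<s. \<forall>a<r. \<forall>b<s. \<rho> (r + j) \<in> \<kappa> a b \<longleftrightarrow> j \<noteq> b"
      by (rule trace_of_productE)
    \<comment> \<open>Row 1 of the identity and row 0 of the complement both have a 0 in column
      \<open>(0, 0)\<close>.\<close>
    have "\<rho> 1 \<notin> \<kappa> 0 0" "\<rho> r \<notin> \<kappa> 0 0" "\<kappa> 0 0 \<in> ?C"
      using assms \<kappa>(1)[rule_format, of 0 0] \<kappa>(2)[rule_format, of 1 0 0]
        \<kappa>(3)[rule_format, of 0 0 0] by simp_all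
    moreover have "\<rho> 1 \<noteq> \<rho> r"
      using \<rho>(1) assms by (auto simp: inj_on_eq_iff)
    moreover have "\<rho> 1 \<in> {..<m}" "\<rho> r \<in> {..<m}"
      using assms by (intro subsetD[OF \<rho>(2)] imageI; simp)+
    ultimately show False by auto
  qed
  ultimately have "card ?C \<le> forb m {Q3 t, 1\<^sub>m r \<times>\<^sub>c complement_mat (1\<^sub>m s)}"
    by (intro card_le_forb) auto
  moreover have "inj_on (\<lambda>i. {..<m} - {i}) {..<m}"
    by (auto simp: inj_on_def)
  ultimately show ?thesis by (simp add: card_image)
qed

section \<open>Cuts containing half of the edges\<close>

definition crossing :: "'a set \<Rightarrow> 'a set \<Rightarrow> bool" where
  "crossing Y e \<longleftrightarrow> e \<inter> Y \<noteq> {} \<and> e - Y \<noteq> {}"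

text \<open>Vertices are placed one at a time. Edges avoiding the new vertex \<open>v\<close> keep
  their status wherever \<open>v\<close> goes, and one of the two placements cuts at least half of
  the edges at \<open>v\<close>.\<close>

lemma large_cut_exists:
  assumes "finite V" "\<And>e. e \<in> E \<Longrightarrow> e \<subseteq> V \<and> card e = 2"
  shows "\<exists>Y\<subseteq>V. card E \<le> 2 * card {e \<in> E. crossing Y e}"
  using assms
proof (induction V arbitrary: E rule: finite_induct)
  case empty
  then have "E = {}" by fastforce
  then show ?case by simp
next
  case (insert v V)
  define E0 where "E0 = {e \<in> E. v \<notin> e}"
  have "\<exists>Y\<subseteq>V. card E0 \<le> 2 * card {e \<in> E0. crossing Y e}"
    using insert.prems by (intro insert.IH) (auto simp: E0_def)
  then obtain Y where Y: "Y \<subseteq> V" "card E0 \<le> 2 * card {e \<in> E0. crossing Y e}" by blast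
  \<comment> \<open>v goes to the side opposite to the majority of its neighbours\<close>
  define N1 N2 where "N1 = {e \<in> E. v \<in> e \<and> e \<inter> Y \<noteq> {}}" and "N2 = {e \<in> E. v \<in> e \<and> e \<inter> Y = {}}"
  have "E \<subseteq> Pow (insert v V)" using insert.prems by auto
  then have fin: "finite E" using insert.hyps(1) by (meson finite.insertI finite_Pow_iff finite_subset)
  have vY: "v \<notin> Y" using insert.hyps Y by auto
  have "E = E0 \<union> (N1 \<union> N2)" by (auto simp: E0_def N1_def N2_def)
  then have "card E \<le> card E0 + (card N1 + card N2)"
    by (metis card_Un_le le_trans add_left_mono)
  moreover have "card {e \<in> E0. crossing Y e} + card N1 = card ({e \<in> E0. crossing Y e} \<union> N1)"
    using fin by (intro card_Un_disjoint[symmetric]) (auto simp: E0_def N1_def)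
  moreover have "\<dots> \<le> card {e \<in> E. crossing Y e}"
    using fin vY by (intro card_mono) (auto simp: E0_def N1_def crossing_def)
  moreover have "card {e \<in> E0. crossing Y e} + card N2 = card ({e \<in> E0. crossing Y e} \<union> N2)"
    using fin by (intro card_Un_disjoint[symmetric]) (auto simp: E0_def N2_def)
  moreover have "\<dots> \<le> card {e \<in> E. crossing (insert v Y) e}"
  proof (intro card_mono)
    \<comment> \<open>The second endpoint of such an edge lies outside \<open>Y\<close> and differs
      from \<open>v\<close>, so the edge is cut once \<open>v\<close> joins
      \<open>Y\<close>.\<close>
    have "e - insert v Y \<noteq> {}" if "e \<in> N2" for e
    proof
      assume "e - insert v Y = {}"
      then have "e \<subseteq> {v}" using that by (auto simp: N2_def)
      then have "card e \<le> 1" using card_mono[of "{v}" e] by simp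
      then show False using that insert.prems by (fastforce simp: N2_def)
    qed
    then show "{e \<in> E0. crossing Y e} \<union> N2 \<subseteq> {e \<in> E. crossing (insert v Y) e}"
      by (auto simp: E0_def N2_def crossing_def)
  qed (use fin in simp)
  \<comment> \<open>The two cuts together have at least \<open>card E\<close> edges, so one of them
    has at least half as many.\<close>
  ultimately have "card E \<le> 2 * card {e \<in> E. crossing Y e}
      \<or> card E \<le> 2 * card {e \<in> E. crossing (insert v Y) e}"
    using Y(2) by linarith
  then show ?case using Y(1) by (meson insert_mono subset_insertI2)
qed

section \<open>Complete bipartite subgraphs and the extremal number\<close>

abbreviation has_K :: "nat \<Rightarrow> nat \<Rightarrow> nat pair_pre_digraph \<Rightarrow> bool" where
  "has_K r s G \<equiv> \<exists>H. subgraph H (with_proj G) \<and> complete_bipartite_digraph r s H"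

text \<open>Arcs from \<open>U\<close> to \<open>W\<close> suffice: symmetry supplies the reverse
  arcs, and a common vertex of \<open>U\<close> and \<open>W\<close> would carry a loop.\<close>

lemma has_K_I:
  assumes "pair_graph G" "U \<times> W \<subseteq> parcs G" "card U = r" "card W = s" "r \<ge> 1" "s \<ge> 1"
  shows "has_K r s G"
proof (intro exI conjI)
  interpret pair_graph G by fact
  let ?H = "\<lparr>pverts = U \<union> W, parcs = U \<times> W \<union> W \<times> U\<rparr>"
  \<comment> \<open>A positive \<open>card\<close> excludes the empty set and also infinite sets,
    whose \<open>card\<close> is 0.\<close>
  have ne: "U \<noteq> {}" "W \<noteq> {}" and fin: "finite U" "finite W"
    using assms card.infinite by fastforce+
  have sym: "sym (parcs G)" using pair_sym_arcs by (simp add: symmetric_def)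
  have dis: "U \<inter> W = {}" using assms(2) pair_no_loops by fastforce
  show K: "complete_bipartite_digraph r s (with_proj ?H)"
    unfolding complete_bipartite_digraph_pair_def using fin dis assms by auto
  then interpret H: pair_graph ?H by (rule pair_graphI_complete_bipartite)
  have "U \<union> W \<subseteq> pverts G"
    using assms(2) ne in_arcsD1 in_arcsD2 by blast
  moreover have "U \<times> W \<union> W \<times> U \<subseteq> parcs G"
    using assms(2) sym by (auto dest: symD)
  ultimately show "subgraph (with_proj ?H) (with_proj G)"
    unfolding subgraph_def using wf_digraph H.wf_digraph by auto
qed

lemma complete_bipartite_digraph_commute:
  "complete_bipartite_digraph r s H \<longleftrightarrow> complete_bipartite_digraph s r H"
  unfolding complete_bipartite_digraph_def by (metis Un_commute Int_commute)

text \<open>Excluding the star bounds every degree by \<open>s - 1\<close>; for \<open>s = 1\<close>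
  no edge remains.\<close>

lemma card_edges_le_star:
  assumes "pair_graph G" "pverts G = {..<m}" "\<not> has_K 1 s G" "s \<ge> 1"
  shows "card (edges G) \<le> (s - 1) * m"
proof -
  interpret pair_graph G by fact
  let ?N = "\<lambda>u. {v. (u, v) \<in> parcs G}"
  have finN: "finite (?N u)" for u
    by (rule finite_subset[of _ "{..<m}"]) (use in_arcsD2 assms(2) in auto)
  have deg: "card (?N u) \<le> s - 1" for u
  proof (rule ccontr)
    assume "\<not> card (?N u) \<le> s - 1"
    then have "s \<le> card (?N u)" by simp
    then obtain W where W: "W \<subseteq> ?N u" "card W = s"
      by (meson obtain_subset_with_card_n)
    then have "has_K 1 s G"
      using assms by (intro has_K_I[of G "{u}" W]) auto
    then show False using assms by simp
  qed
  have "edges G \<subseteq> (\<Union>u<m. (\<lambda>v. {u, v}) ` ?N u)"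
    using in_arcsD1 assms(2) by (fastforce simp: edges_def)
  then have "card (edges G) \<le> card (\<Union>u<m. (\<lambda>v. {u, v}) ` ?N u)"
    using finN by (intro card_mono) auto
  also have "\<dots> \<le> (\<Sum>u<m. card ((\<lambda>v. {u, v}) ` ?N u))"
    by (rule card_UN_le) simp
  also have "\<dots> \<le> (\<Sum>u<m. s - 1)"
    using finN deg by (intro sum_mono) (meson card_image_le le_trans)
  finally show ?thesis by (simp add: mult.commute)
qed

text \<open>For \<open>Max\<close> to be meaningful its set must be nonempty and finite: the
  edgeless graph is a member because \<open>r\<close> and \<open>s\<close> are positive, and
  \<open>N\<close> bounds all members.\<close>

lemma ex_bipartite_le:
  assumes "r \<ge> 1" "s \<ge> 1"
    and bound: "\<And>G. pair_graph G \<Longrightarrow> pverts G = {..<m} \<Longrightarrow> \<not> has_K r s G \<Longrightarrow> card (edges G) \<le> N"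
  shows "ex_bipartite m r s \<le> N"
proof -
  let ?S = "{card (edges G) | G. pair_graph G \<and> pverts G = {..<m} \<and> \<not> has_K r s G}"
  let ?E = "\<lparr>pverts = {..<m}, parcs = {}\<rparr>"
  have "pair_graph ?E"
    by unfold_locales (auto simp: symmetric_def sym_def)
  moreover have "\<not> has_K r s ?E"
  proof
    assume "has_K r s ?E"
    then obtain H where "subgraph H (with_proj ?E)" and K: "complete_bipartite_digraph r s H"
      by blast
    then have "arcs_ends H = {}" by (simp add: subgraph_def arcs_ends_def)
    moreover obtain U W where "card U = r" "card W = s" "arcs_ends H = U \<times> W \<union> W \<times> U"
      using K unfolding complete_bipartite_digraph_def by blast
    ultimately show False using assms by auto
  qed
  ultimately have "?S \<noteq> {}" by (auto intro!: exI[of _ ?E])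
  moreover have "finite ?S"
    by (rule finite_subset[of _ "{..N}"]) (use bound in auto)
  ultimately show ?thesis
    unfolding ex_bipartite_def using bound by (intro Max.boundedI) auto
qed

section \<open>The family of columns built from a cut\<close>

lemma edges_cutE:
  assumes "pair_graph G" "e \<in> edges G" "crossing Y e"
  obtains x y where "e = {x, y}" "x \<notin> Y" "y \<in> Y" "(x, y) \<in> parcs G"
proof -
  interpret pair_graph G by fact
  have "sym (parcs G)" using pair_sym_arcs by (simp add: symmetric_def)
  obtain u v where "e = {u, v}" "(u, v) \<in> parcs G" "(v, u) \<in> parcs G"
    using assms(2) \<open>sym (parcs G)\<close> by (auto simp: edges_def dest: symD)
  then show thesis
    using assms(3) that[of u v] that[of v u] by (auto simp: crossing_def)
qed

text \<open>The factor 2 is the loss in passing to the cut; the edges of the cut inject into the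
  columns.\<close>

lemma card_edges_le_forb:
  assumes "t \<ge> 2" "r \<ge> 2" "s \<ge> 2"
    and G: "pair_graph G" "pverts G = {..<m}" and free: "\<not> has_K r s G"
  shows "card (edges G) \<le> 2 * forb m {Q3 t, 1\<^sub>m r \<times>\<^sub>c complement_mat (1\<^sub>m s)}"
proof -
  interpret pair_graph G by fact
  have "e \<subseteq> {..<m} \<and> card e = 2" if e: "e \<in> edges G" for e
  proof -
    obtain u v where "e = {u, v}" "(u, v) \<in> parcs G" using e by (auto simp: edges_def)
    moreover have "u \<noteq> v" using pair_no_loops calculation by fastforce
    ultimately show ?thesis using in_arcsD1 in_arcsD2 G(2) by auto
  qed
  then obtain Y where Y: "Y \<subseteq> {..<m}" "card (edges G) \<le> 2 * card {e \<in> edges G. crossing Y e}"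
    using large_cut_exists[of "{..<m}" "edges G"] by blast
  define column where "column x y = insert x (Y - {y})" for x y
  define C where "C = {column x y | x y. x \<notin> Y \<and> y \<in> Y \<and> (x, y) \<in> parcs G}"
  \<comment> \<open>Each column has a single 1 outside \<open>Y\<close> and a single 0 inside
    \<open>Y\<close>, so two vertices outside never show 11 and two inside never show 00.\<close>
  have same_side: False if "c \<in> C" "c' \<in> C" "u \<noteq> v" "u \<in> Y \<longleftrightarrow> v \<in> Y"
    "u \<in> c" "v \<in> c" "u \<notin> c'" "v \<notin> c'" for c c' u v
    using that by (auto simp: C_def column_def)
  \<comment> \<open>A 1 outside \<open>Y\<close> identifies \<open>x\<close> and a 0 inside
    \<open>Y\<close> identifies \<open>y\<close>, so the pattern determines the column and its
    arc.\<close>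
  have cross: "c = column u v \<and> (u, v) \<in> parcs G"
    if "c \<in> C" "u \<notin> Y" "v \<in> Y" "u \<in> c" "v \<notin> c" for c u v
    using that by (auto simp: C_def column_def)
  have "\<not> trace_of (Q3 t) {..<m} C"
  proof
    assume "trace_of (Q3 t) {..<m} C"
    then show False
    proof (rule trace_of_Q3E[OF _ assms(1)])
      fix u v a b c c' d d'
      assume *: "u \<noteq> v" "{a, b, c, c', d, d'} \<subseteq> C" "u \<notin> a" "v \<notin> a" "u \<in> b" "v \<in> b"
        "c \<noteq> c'" "u \<in> c" "v \<notin> c" "u \<in> c'" "v \<notin> c'"
        "d \<noteq> d'" "u \<notin> d" "v \<in> d" "u \<notin> d'" "v \<in> d'"
      \<comment> \<open>On one side, 11 and 00 clash. Across the cut, two different columns with a 1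
        outside and a 0 inside \<open>Y\<close> would coincide: \<open>c\<close> and
        \<open>c'\<close> or \<open>d\<close> and \<open>d'\<close>, depending on the
        orientation.\<close>
      consider "u \<in> Y \<longleftrightarrow> v \<in> Y" | "u \<notin> Y" "v \<in> Y" | "v \<notin> Y" "u \<in> Y" by blast
      then show False
      proof cases
        case 1
        then show False using same_side[of b a u v] * by blast
      next
        case 2
        then show False using cross[of c u v] cross[of c' u v] * by blast
      next
        case 3
        then show False using cross[of d v u] cross[of d' v u] * by blast
      qed
    qed
  qed
  moreover have "\<not> trace_of (1\<^sub>m r \<times>\<^sub>c complement_mat (1\<^sub>m s)) {..<m} C"
  proof
    assume "trace_of (1\<^sub>m r \<times>\<^sub>c complement_mat (1\<^sub>m s)) {..<m} C"
    then obtain \<rho> \<kappa> where \<rho>: "inj_on \<rho> {..<r + s}"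
      and C: "\<forall>a<r. \<forall>b<s. \<kappa> a b \<in> C"
      and I: "\<forall>i<r. \<forall>a<r. \<forall>b<s. \<rho> i \<in> \<kappa> a b \<longleftrightarrow> i = a"
      and J: "\<forall>j<s. \<forall>a<r. \<forall>b<s. \<rho> (r + j) \<in> \<kappa> a b \<longleftrightarrow> j \<noteq> b"
      by (rule trace_of_productE)
    note C = C[rule_format] and I = I[rule_format] and J = J[rule_format]
    have arc: "(\<rho> i, \<rho> (r + j)) \<in> parcs G" if ij: "i < r" "j < s" for i j
    proof -
      \<comment> \<open>indices different from i and j exist because r and s are at least 2\<close>
      define a b where "a = (if i = 0 then 1 else 0 :: nat)" and "b = (if j = 0 then 1 else 0 :: nat)"
      have ab: "a < r" "b < s" "a \<noteq> i" "b \<noteq> j" using assms(2,3) by (auto simp: a_def b_def)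
      have "\<rho> i \<noteq> \<rho> (r + j)" using \<rho> ij by (auto simp: inj_on_eq_iff)
      \<comment> \<open>On these two rows column \<open>(i, b)\<close> shows 11 and column
        \<open>(a, j)\<close> shows 00.\<close>
      then have "(\<rho> i \<in> Y) \<noteq> (\<rho> (r + j) \<in> Y)"
        using same_side[of "\<kappa> i b" "\<kappa> a j" "\<rho> i" "\<rho> (r + j)"] C I J ij ab by auto
      then consider "\<rho> i \<notin> Y" "\<rho> (r + j) \<in> Y" | "\<rho> (r + j) \<notin> Y" "\<rho> i \<in> Y" by blast
      then show ?thesis
      proof cases
        \<comment> \<open>Column \<open>(i, j)\<close> has a 1 in the row outside \<open>Y\<close>
          and a 0 in the row inside.\<close>
        case 1
        then show ?thesis
          using cross[of "\<kappa> i j" "\<rho> i" "\<rho> (r + j)"] C I J ij by auto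
      next
        \<comment> \<open>With the sides exchanged, column \<open>(a, b)\<close> does this, and
          symmetry reverses the arc.\<close>
        case 2
        then have "(\<rho> (r + j), \<rho> i) \<in> parcs G"
          using cross[of "\<kappa> a b" "\<rho> (r + j)" "\<rho> i"] C I J ij ab by auto
        then show ?thesis
          using pair_sym_arcs by (simp add: symmetric_def symD)
      qed
    qed
    have "has_K r s G"
    proof (rule has_K_I[OF G(1)])
      show "\<rho> ` {..<r} \<times> (\<lambda>j. \<rho> (r + j)) ` {..<s} \<subseteq> parcs G" using arc by auto
      show "card (\<rho> ` {..<r}) = r"
        using card_image[of \<rho> "{..<r}"] inj_on_subset[OF \<rho>, of "{..<r}"] by auto
      have "inj_on (\<lambda>j. \<rho> (r + j)) {..<s}"
        using \<rho> by (auto intro!: inj_onI dest: inj_onD)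
      then show "card ((\<lambda>j. \<rho> (r + j)) ` {..<s}) = s" by (simp add: card_image)
    qed (use assms in auto)
    then show False using free by simp
  qed
  moreover have "C \<subseteq> Pow {..<m}"
    using Y(1) in_arcsD1 G(2) by (fastforce simp: C_def column_def)
  ultimately have "card C \<le> forb m {Q3 t, 1\<^sub>m r \<times>\<^sub>c complement_mat (1\<^sub>m s)}"
    by (intro card_le_forb) auto
  moreover have "card {e \<in> edges G. crossing Y e} \<le> card C"
  proof (rule card_inj_on_le)
    \<comment> \<open>Symmetric difference with \<open>Y\<close> is an involution, hence injective,
      and sends \<open>{x, y}\<close> to \<open>column x y\<close> without choosing an orientation
      of the edge.\<close>
    show "inj_on (\<lambda>e. (e - Y) \<union> (Y - e)) {e \<in> edges G. crossing Y e}"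
      by (rule inj_onI) blast
    show "(\<lambda>e. (e - Y) \<union> (Y - e)) ` {e \<in> edges G. crossing Y e} \<subseteq> C"
    proof (rule image_subsetI)
      fix e assume "e \<in> {e \<in> edges G. crossing Y e}"
      then obtain x y where "e = {x, y}" "x \<notin> Y" "y \<in> Y" "(x, y) \<in> parcs G"
        using edges_cutE[OF G(1)] by blast
      moreover from this have "(e - Y) \<union> (Y - e) = column x y" by (auto simp: column_def)
      ultimately show "(e - Y) \<union> (Y - e) \<in> C" by (auto simp: C_def)
    qed
    show "finite C" using \<open>C \<subseteq> Pow {..<m}\<close> by (rule finite_subset) simp
  qed
  ultimately show ?thesis using Y(2) by linarith
qed

section \<open>Comparison of the two growth rates\<close>

theorem theorem4p12:
  fixes t r s :: nat
  assumes "t \<ge> 2" and "r \<ge> 1" and "s \<ge> 1"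
  shows "(\<lambda>m. real (forb m {Q3 t, 1\<^sub>m r \<times>\<^sub>c complement_mat (1\<^sub>m s)}))
           \<in> \<Omega>(\<lambda>m. real (ex_bipartite m r s))"
proof -
  let ?f = "\<lambda>m. forb m {Q3 t, 1\<^sub>m r \<times>\<^sub>c complement_mat (1\<^sub>m s)}"
  \<comment> \<open>The constant \<open>r + s\<close> dominates the factors 0, \<open>s - 1\<close>,
    \<open>r - 1\<close> and 2 arising in the four cases, so the inequality holds for every
    \<open>m\<close>.\<close>
  have le: "ex_bipartite m r s \<le> (r + s) * ?f m" for m
  proof (rule ex_bipartite_le[OF assms(2,3)])
    fix G assume G: "pair_graph G" "pverts G = {..<m}" "\<not> has_K r s G"
    consider "r = 1" "s = 1" | "r = 1" "s \<ge> 2" | "s = 1" "r \<ge> 2" | "r \<ge> 2" "s \<ge> 2"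
      using assms by linarith
    then show "card (edges G) \<le> (r + s) * ?f m"
    proof cases
      case 1
      then show ?thesis using card_edges_le_star[of G m 1] G by simp
    next
      case 2
      have "card (edges G) \<le> (s - 1) * m" using card_edges_le_star[of G m s] G 2 by simp
      also have "\<dots> \<le> (r + s) * ?f m"
        using forb_ge_identity[OF assms(1,2) 2(2)] by (intro mult_le_mono) auto
      finally show ?thesis .
    next
      case 3
      \<comment> \<open>Exchanging the two classes makes the star bound applicable.\<close>
      have "\<not> has_K 1 r G" using G(3) 3(1) complete_bipartite_digraph_commute by blast
      then have "card (edges G) \<le> (r - 1) * m" using card_edges_le_star[of G m r] G 3 by simp
      also have "\<dots> \<le> (r + s) * ?f m"
        using forb_ge_complement[OF assms(1) 3(2) assms(3)] by (intro mult_le_mono) auto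
      finally show ?thesis .
    next
      case 4
      have "card (edges G) \<le> 2 * ?f m" using card_edges_le_forb[OF assms(1) 4 G] .
      also have "\<dots> \<le> (r + s) * ?f m" using 4 by (intro mult_le_mono1) simp
      finally show ?thesis .
    qed
  qed
  show ?thesis
  proof (rule landau_omega.bigI[of "1 / real (r + s)"])
    show "0 < 1 / real (r + s)" using assms by simp
    have "1 / real (r + s) * real (ex_bipartite m r s) \<le> real (?f m)" for m
    proof -
      have "real (ex_bipartite m r s) \<le> real (r + s) * real (?f m)"
        using le[of m] by (metis of_nat_le_iff of_nat_mult)
      then show ?thesis using assms by (simp add: field_simps)
    qed
    then show "\<forall>\<^sub>F m in at_top. norm (real (?f m)) \<ge> 1 / real (r + s) * norm (real (ex_bipartite m r s))"
      by simp
  qed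
qed

end
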